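(* Let $k$ be a positive integer, and let $\varsigma_1<\varsigma_2<\cdots$, $w_k,\alpha_k,\beta_k,\gamma_k,\delta_k,\epsilon_k$ be as defined in the context. Then: (i) if $n=(2k-1)^2$, then $n$ is the $w_k$-th term of $\{\varsigma_m\}_{m=1}^\infty$, i.e. $\varsigma_{w_k}=(2k-1)^2$; (ii) if $n=4k^2$, then $n$ is the $\alpha_k$-th term of $\{\varsigma_m\}_{m=1}^\infty$; (iii) if $n=k^2$, then $n$ is the $\beta_k$-th term of $\{\varsigma_m\}_{m=1}^\infty$; (iv) if $n=2(2k-1)^2$, then $n$ is the $\gamma_k$-th term of $\{\varsigma_m\}_{m=1}^\infty$; (v) if $n=8k^2$, then $n$ is the $\delta_k$-th term of $\{\varsigma_m\}_{m=1}^\infty$; (vi) if $n=2k^2$, then $n$ is the $\epsilon_k$-th term of $\{\varsigma_m\}_{m=1}^\infty$.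
   Context: For a positive integer $n$, $\sigma(n)=\sum_{d\mid n} d$. The sequence $\{\varsigma_m\}_{m=1}^\infty$ is the strictly increasing sequence of all positive integers $n$ with $\sigma(n)$ odd (indexed from $m=1$). For $k\ge 1$ define $w_k=\lfloor (k-1/2)(2+\sqrt2)\rfloor$ (OEIS A001954, the $k$-th winning position in the 2-Wythoff game), $\alpha_k=\lfloor k(2+\sqrt2)\rfloor$, $\beta_k=\lfloor k(2+\sqrt2)/2\rfloor$, $\gamma_k=\lfloor (k-1/2)(2+2\sqrt2)\rfloor$, $\delta_k=\lfloor k(2+2\sqrt2)\rfloor$, $\epsilon_k=\lfloor k(1+\sqrt2)\rfloor$. *)

theory Defs
  imports Complex_Main "HOL-Library.Infinite_Set" "HOL-Computational_Algebra.Primes"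
begin

definition sigma :: "nat \<Rightarrow> nat" where
  "sigma n = (\<Sum>d | d dvd n. d)"

definition odd_sigma_set :: "nat set" where
  "odd_sigma_set = {n. n > 0 \<and> odd (sigma n)}"

(* The sequence is indexed from 1, whereas enumerate counts from 0.  Index 0 carries no term;
   the dummy value 0 is not an element of odd_sigma_set. *)
definition varsigma :: "nat \<Rightarrow> nat" where
  "varsigma m = (if m = 0 then 0 else enumerate odd_sigma_set (m - 1))"

(* In the following definitions the floors are nonnegative for k \<ge> 1, so nat does not truncate. *)

definition w_seq :: "nat \<Rightarrow> nat" where
  "w_seq k = nat \<lfloor>(real k - 1 / 2) * (2 + sqrt 2)\<rfloor>"

definition alpha_seq :: "nat \<Rightarrow> nat" where
  "alpha_seq k = nat \<lfloor>real k * (2 + sqrt 2)\<rfloor>"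

definition beta_seq :: "nat \<Rightarrow> nat" where
  "beta_seq k = nat \<lfloor>real k * (2 + sqrt 2) / 2\<rfloor>"

definition gamma_seq :: "nat \<Rightarrow> nat" where
  "gamma_seq k = nat \<lfloor>(real k - 1 / 2) * (2 + 2 * sqrt 2)\<rfloor>"

definition delta_seq :: "nat \<Rightarrow> nat" where
  "delta_seq k = nat \<lfloor>real k * (2 + 2 * sqrt 2)\<rfloor>"

definition epsilon_seq :: "nat \<Rightarrow> nat" where
  "epsilon_seq k = nat \<lfloor>real k * (1 + sqrt 2)\<rfloor>"

lemma odd_sigma_power_2: "odd (sigma (2 ^ k))"
proof -
  let ?A = "{d. d dvd (2::nat) ^ k}"
  have fin: "finite ?A"
    by (rule finite_divisors_nat) simp
  have "sigma (2 ^ k) = 1 + (\<Sum>d\<in>?A - {1}. d)"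
    unfolding sigma_def by (rule sum.remove[OF fin]) simp
  moreover have "even (\<Sum>d\<in>?A - {1}. d)"
  proof (rule dvd_sum)
    fix d :: nat
    assume d: "d \<in> ?A - {1}"
    then obtain i where "d = 2 ^ i"
      using divides_primepow_nat[OF two_is_prime_nat, of d k] by blast
    with d show "even d"
      by (cases i) simp_all
  qed
  ultimately show ?thesis by simp
qed

lemma infinite_odd_sigma_set: "infinite odd_sigma_set"
proof -
  have "infinite (range (\<lambda>k. (2::nat) ^ k))"
    by (rule range_inj_infinite) (auto simp: inj_def)
  moreover have "range (\<lambda>k. (2::nat) ^ k) \<subseteq> odd_sigma_set"
    by (auto simp: odd_sigma_set_def odd_sigma_power_2)
  ultimately show ?thesis
    using infinite_super by blast
qed

lemma strict_mono_on_varsigma: "strict_mono_on {1..} varsigma"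
  by (auto simp: strict_mono_on_def varsigma_def infinite_odd_sigma_set)

lemma varsigma_image: "varsigma ` {1..} = odd_sigma_set"
proof
  show "varsigma ` {1..} \<subseteq> odd_sigma_set"
    by (auto simp: varsigma_def enumerate_in_set[OF infinite_odd_sigma_set])
  show "odd_sigma_set \<subseteq> varsigma ` {1..}"
  proof
    fix s assume "s \<in> odd_sigma_set"
    then obtain n where "s = varsigma (Suc n)"
      using enumerate_Ex[OF infinite_odd_sigma_set, of s] by (auto simp: varsigma_def)
    then show "s \<in> varsigma ` {1..}"
      by (rule image_eqI) simp
  qed
qed

end

theory Submission
  imports Defs "HOL-Computational_Algebra.Nth_Powers"
begin

text \<open>
  The parity of \<open>\<sigma>(n)\<close> is that of the number of odd divisors of \<open>n\<close>, that is, of the number of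
  divisors of the odd part of \<open>n\<close>, and pairing \<open>d\<close> with \<open>m / d\<close> shows that a number \<open>m\<close> has an odd
  number of divisors iff it is a square.  Hence \<open>\<sigma>(n)\<close> is odd iff \<open>n\<close> is a square or twice a square,
  and exactly \<open>\<lfloor>\<surd>N\<rfloor> + \<lfloor>\<surd>(N/2)\<rfloor>\<close> terms of the sequence are at most \<open>N\<close>.  For \<open>N = k\<^sup>2\<close> this
  number is \<open>\<beta>\<^sub>k\<close>, for \<open>N = 2k\<^sup>2\<close> it is \<open>\<epsilon>\<^sub>k\<close>, and the other four sequences consist of the odd- and
  even-indexed terms of these two.
\<close>

lemma odd_card_divisors_iff:
  fixes m :: nat
  assumes "m > 0"
  shows "odd (card {d. d dvd m}) \<longleftrightarrow> is_nth_power 2 m"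
proof -
  let ?L = "{d. d dvd m \<and> d * d < m}" and ?G = "{d. d dvd m \<and> d * d > m}"
    and ?E = "{d. d dvd m \<and> d * d = m}"
  have fin: "finite {d. d dvd m}"
    using assms by (simp add: finite_divisors_nat)
  have finL: "finite ?L" and finG: "finite ?G" and finE: "finite ?E"
    by (auto intro: finite_subset[OF _ fin])
  have swap_less: "m div d * (m div d) > m" if "d dvd m" "d * d < m" for d
  proof -
    from that(1) obtain e where e: "m = d * e" ..
    with assms that show ?thesis by auto
  qed
  have swap_greater: "m div d * (m div d) < m" if "d dvd m" "d * d > m" for d
  proof -
    from that(1) obtain e where e: "m = d * e" ..
    with assms that show ?thesis by auto
  qed
  \<comment> \<open>Since \<open>m div (m div d) = d\<close> for every divisor \<open>d\<close> of
    \<open>m > 0\<close>, the map is its own inverse. Only a divisor with \<open>d * d = m\<close>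
    stays unpaired, and there is at most one.\<close>
  have "bij_betw (\<lambda>d. m div d) ?L ?G"
    using assms swap_less swap_greater
    by (intro bij_betw_byWitness[where f' = "\<lambda>d. m div d"]) (auto simp: div_dvd_div)
  then have LG: "card ?L = card ?G"
    by (rule bij_betw_same_card)
  have "{d. d dvd m} = (?L \<union> ?G) \<union> ?E"
    by auto
  moreover have "card ((?L \<union> ?G) \<union> ?E) = card (?L \<union> ?G) + card ?E"
    using finL finG finE by (intro card_Un_disjoint) auto
  moreover have "card (?L \<union> ?G) = card ?L + card ?G"
    using finL finG by (rule card_Un_disjoint) auto
  ultimately have "card {d. d dvd m} = 2 * card ?L + card ?E"
    using LG by (simp only: mult_2)
  then have parity: "odd (card {d. d dvd m}) \<longleftrightarrow> odd (card ?E)"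
    by simp
  show ?thesis
  proof (cases "is_nth_power 2 m")
    case True
    then obtain r where r: "m = r\<^sup>2"
      by (auto elim: is_nth_powerE)
    then have "?E = {r}"
      by (auto simp flip: power2_eq_square)
    with parity True show ?thesis by simp
  next
    case False
    then have "?E = {}"
      by (auto simp: is_nth_power_def power2_eq_square)
    with parity False show ?thesis by simp
  qed
qed

lemma odd_sigma_iff:
  assumes "n > 0"
  shows "odd (sigma n) \<longleftrightarrow> is_nth_power 2 n \<or> is_nth_power 2 (2 * n)"
proof -
  obtain m where n: "n = 2 ^ multiplicity 2 n * m" and m: "odd m"
    using multiplicity_decompose'[of n 2] assms by auto
  define a where "a = multiplicity 2 n"
  have n: "n = 2 ^ a * m"
    using n by (simp add: a_def)
  have cop: "coprime (2 ^ i) m" for i :: nat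
    using m by simp
  have "m > 0"
    using m by (cases m) auto
  have "{d. d dvd n \<and> odd d} = {d. d dvd m}"
  proof (intro Collect_cong iffI conjI)
    fix d assume d: "d dvd n \<and> odd d"
    then have "coprime d (2 ^ a)"
      by simp
    with d show "d dvd m"
      unfolding n by (simp only: coprime_dvd_mult_right_iff)
  qed (use n m in \<open>auto intro: dvd_trans\<close>)
  then have "odd (sigma n) \<longleftrightarrow> odd (card {d. d dvd m})"
    using assms by (simp add: sigma_def even_sum_iff finite_divisors_nat Collect_conj_eq)
  also have "\<dots> \<longleftrightarrow> is_nth_power 2 m"
    using \<open>m > 0\<close> by (rule odd_card_divisors_iff)
  \<comment> \<open>A product of coprime factors is a square iff both factors are. Exactly one of
    \<open>a\<close> and \<open>Suc a\<close> is even, so exactly one of the two powers of 2 is a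
    square.\<close>
  also have "\<dots> \<longleftrightarrow> is_nth_power 2 (2 ^ a * m) \<or> is_nth_power 2 (2 ^ Suc a * m)"
    unfolding is_nth_power_mult_coprime_nat_iff[OF cop]
      is_nth_power_prime_power_nat_iff[OF two_is_prime_nat] by auto
  finally show ?thesis
    by (simp add: n mult.assoc)
qed

text \<open>A square root of \<open>2 * n\<close> has to be even, and half of it serves as
  \<open>j\<close>.\<close>

lemma is_square_double_iff: "is_nth_power 2 (2 * n) \<longleftrightarrow> (\<exists>j. n = 2 * j\<^sup>2)" for n :: nat
proof
  assume "is_nth_power 2 (2 * n)"
  then obtain i where i: "2 * n = i\<^sup>2"
    by (auto elim: is_nth_powerE)
  then have "even i"
    by (metis dvd_triv_left even_power)
  then obtain j where "i = 2 * j" ..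
  with i have "n = 2 * j\<^sup>2"
    by (simp add: power_mult_distrib)
  then show "\<exists>j. n = 2 * j\<^sup>2" ..
next
  assume "\<exists>j. n = 2 * j\<^sup>2"
  then obtain j where "n = 2 * j\<^sup>2" ..
  then have "2 * n = (2 * j)\<^sup>2"
    by (simp add: power_mult_distrib)
  then show "is_nth_power 2 (2 * n)"
    by (rule is_nth_powerI)
qed

text \<open>The bounds \<open>j > 0\<close> keep out \<open>0\<close>, which is a square but not a
  term of the sequence.\<close>

lemma odd_sigma_set_iff:
  "n \<in> odd_sigma_set \<longleftrightarrow> (\<exists>j>0. n = j\<^sup>2) \<or> (\<exists>j>0. n = 2 * j\<^sup>2)"
proof (cases "n = 0")
  case False
  then show ?thesis
    by (auto simp: odd_sigma_set_def odd_sigma_iff is_square_double_iff)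
      (auto simp: is_nth_power_def)
qed (auto simp: odd_sigma_set_def)

text \<open>This is the irrationality of the square root of 2. It makes the squares and the doubled
  squares disjoint, so that their counts add up.\<close>

lemma square_neq_double_square:
  fixes i j :: nat
  assumes "j > 0"
  shows "i\<^sup>2 \<noteq> 2 * j\<^sup>2"
proof
  assume "i\<^sup>2 = 2 * j\<^sup>2"
  then have "is_nth_power 2 (2 * j\<^sup>2)"
    by (metis is_nth_power_nth_power)
  \<comment> \<open>Cancelling the nonzero square \<open>j\<^sup>2\<close> leaves a prime power with
    odd exponent, which is not a square.\<close>
  then have "is_nth_power 2 ((2 :: nat) ^ 1)"
    using assms by (simp add: is_nth_power_mult_cancel_right)
  then show False
    unfolding is_nth_power_prime_power_nat_iff[OF two_is_prime_nat] by simp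
qed

text \<open>The \<open>j\<close> with \<open>j\<^sup>2\<close> at most \<open>x\<close> thus form an
  initial interval, which is what turns counting squares into a floor.\<close>

lemma le_nat_floor_sqrt_iff: "j \<le> nat \<lfloor>sqrt x\<rfloor> \<longleftrightarrow> real (j\<^sup>2) \<le> x" if "x \<ge> 0"
proof -
  have "j \<le> nat \<lfloor>sqrt x\<rfloor> \<longleftrightarrow> real j \<le> sqrt x"
    using that by (simp add: le_nat_iff le_floor_iff)
  also have "\<dots> \<longleftrightarrow> real (j\<^sup>2) \<le> x"
    using that by (metis of_nat_0_le_iff of_nat_power real_le_rsqrt real_sqrt_le_iff
      real_sqrt_pow2_iff real_sqrt_unique sqrt_le_D)
  finally show ?thesis .
qed

lemma card_odd_sigma_set_le:
  "card {s \<in> odd_sigma_set. s \<le> N} = nat \<lfloor>sqrt (real N)\<rfloor> + nat \<lfloor>sqrt (real N / 2)\<rfloor>"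
proof -
  let ?a = "nat \<lfloor>sqrt (real N)\<rfloor>" and ?b = "nat \<lfloor>sqrt (real N / 2)\<rfloor>"
  have a: "j \<le> ?a \<longleftrightarrow> j\<^sup>2 \<le> N" for j
    by (subst le_nat_floor_sqrt_iff) (simp_all del: of_nat_power)
  have b: "j \<le> ?b \<longleftrightarrow> 2 * j\<^sup>2 \<le> N" for j
  proof -
    have "j \<le> ?b \<longleftrightarrow> real (2 * j\<^sup>2) \<le> real N"
      by (subst le_nat_floor_sqrt_iff) (auto simp: field_simps)
    then show ?thesis
      by (simp only: of_nat_le_iff)
  qed
  have "{s \<in> odd_sigma_set. s \<le> N} = (\<lambda>j. j\<^sup>2) ` {0<..?a} \<union> (\<lambda>j. 2 * j\<^sup>2) ` {0<..?b}"
    by (auto simp: odd_sigma_set_iff a b)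
  also have "card \<dots> = card ((\<lambda>j. j\<^sup>2) ` {0<..?a}) + card ((\<lambda>j. 2 * j\<^sup>2) ` {0<..?b})"
    by (intro card_Un_disjoint) (auto simp: square_neq_double_square)
  also have "\<dots> = ?a + ?b"
    by (simp add: card_image inj_on_def)
  finally show ?thesis .
qed

text \<open>The enumeration is increasing and exhausts \<open>S\<close>, and its indices
  \<open>0\<close> to \<open>n\<close> are \<open>Suc n\<close> in number.\<close>

lemma card_enumerate_le:
  fixes S :: "nat set"
  assumes "infinite S"
  shows "card {s \<in> S. s \<le> enumerate S n} = Suc n"
proof -
  have "{s \<in> S. s \<le> enumerate S n} = enumerate S ` {..n}"
  proof (intro equalityI subsetI)
    fix s assume s: "s \<in> {s \<in> S. s \<le> enumerate S n}"
    then obtain i where "s = enumerate S i"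
      using enumerate_Ex[OF assms, of s] by auto
    with s assms show "s \<in> enumerate S ` {..n}"
      by simp
  qed (use assms in \<open>auto simp: enumerate_in_set\<close>)
  then show ?thesis
    by (simp add: card_image inj_on_subset[OF inj_enumerate[OF assms]])
qed

text \<open>The index of a term is the number of terms up to it; the \<open>Suc n\<close> of the
  count cancels the shift \<open>m - 1\<close> in \<open>varsigma\<close>.\<close>

lemma varsigma_rank:
  assumes "x \<in> odd_sigma_set"
  shows "varsigma (nat \<lfloor>sqrt (real x)\<rfloor> + nat \<lfloor>sqrt (real x / 2)\<rfloor>) = x"
proof -
  obtain n where n: "enumerate odd_sigma_set n = x"
    using enumerate_Ex[OF infinite_odd_sigma_set assms] by blast
  then have "nat \<lfloor>sqrt (real x)\<rfloor> + nat \<lfloor>sqrt (real x / 2)\<rfloor> = Suc n"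
    using card_enumerate_le[OF infinite_odd_sigma_set, of n] by (simp add: card_odd_sigma_set_le)
  then show ?thesis
    by (simp add: varsigma_def n)
qed

lemma nat_floor_of_nat_add: "nat \<lfloor>real k + x\<rfloor> = k + nat \<lfloor>x\<rfloor>" if "x \<ge> 0"
  using that by (simp add: nat_add_distrib)

text \<open>At \<open>k\<^sup>2\<close> the first of the two roots is the integer \<open>k\<close>,
  so the sum of the two floors is a single floor.\<close>

lemma varsigma_beta_seq:
  assumes "k \<ge> 1"
  shows "varsigma (beta_seq k) = k\<^sup>2"
proof -
  have eq: "real k * (2 + sqrt 2) / 2 = real k + sqrt (real (k\<^sup>2) / 2)"
    by (simp add: real_sqrt_divide field_simps)
  have "beta_seq k = nat \<lfloor>sqrt (real (k\<^sup>2))\<rfloor> + nat \<lfloor>sqrt (real (k\<^sup>2) / 2)\<rfloor>"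
    unfolding beta_seq_def eq by (subst nat_floor_of_nat_add) simp_all
  moreover have "k\<^sup>2 \<in> odd_sigma_set"
    using assms by (auto simp: odd_sigma_set_iff)
  ultimately show ?thesis
    using varsigma_rank by metis
qed

text \<open>At \<open>2 * k\<^sup>2\<close> it is the second root that equals
  \<open>k\<close>.\<close>

lemma varsigma_epsilon_seq:
  assumes "k \<ge> 1"
  shows "varsigma (epsilon_seq k) = 2 * k\<^sup>2"
proof -
  have eq: "real k * (1 + sqrt 2) = real k + sqrt (real (2 * k\<^sup>2))"
    by (simp add: real_sqrt_mult field_simps)
  have "epsilon_seq k
      = nat \<lfloor>sqrt (real (2 * k\<^sup>2))\<rfloor> + nat \<lfloor>sqrt (real (2 * k\<^sup>2) / 2)\<rfloor>"
    unfolding epsilon_seq_def eq by (subst nat_floor_of_nat_add) simp_all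
  moreover have "2 * k\<^sup>2 \<in> odd_sigma_set"
    using assms by (auto simp: odd_sigma_set_iff)
  ultimately show ?thesis
    using varsigma_rank by metis
qed

theorem proposition22:
  fixes k :: nat
  assumes "k \<ge> 1"
  shows "varsigma (w_seq k) = (2 * k - 1)\<^sup>2
    \<and> varsigma (alpha_seq k) = 4 * k\<^sup>2
    \<and> varsigma (beta_seq k) = k\<^sup>2
    \<and> varsigma (gamma_seq k) = 2 * (2 * k - 1)\<^sup>2
    \<and> varsigma (delta_seq k) = 8 * k\<^sup>2
    \<and> varsigma (epsilon_seq k) = 2 * k\<^sup>2"
proof -
  \<comment> \<open>By \<open>k \<ge> 1\<close> the subtraction on \<open>nat\<close> does not
    truncate, and the half-integers in \<open>w_seq\<close> and \<open>gamma_seq\<close> become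
    halves of odd indices.\<close>
  have odd: "real (2 * k - 1) = 2 * (real k - 1 / 2)"
    using assms by simp
  have "real (2 * k - 1) * (2 + sqrt 2) / 2 = (real k - 1 / 2) * (2 + sqrt 2)"
    and "real (2 * k - 1) * (1 + sqrt 2) = (real k - 1 / 2) * (2 + 2 * sqrt 2)"
    unfolding odd by (simp_all add: field_simps)
  then have "w_seq k = beta_seq (2 * k - 1)" "gamma_seq k = epsilon_seq (2 * k - 1)"
    by (simp_all only: w_seq_def beta_seq_def gamma_seq_def epsilon_seq_def)
  moreover have "real (2 * k) * (2 + sqrt 2) / 2 = real k * (2 + sqrt 2)"
    and "real (2 * k) * (1 + sqrt 2) = real k * (2 + 2 * sqrt 2)"
    by (simp_all add: field_simps)
  then have "alpha_seq k = beta_seq (2 * k)" "delta_seq k = epsilon_seq (2 * k)"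
    by (simp_all only: alpha_seq_def beta_seq_def delta_seq_def epsilon_seq_def)
  ultimately show ?thesis
    using assms varsigma_beta_seq[of k] varsigma_beta_seq[of "2 * k"]
      varsigma_beta_seq[of "2 * k - 1"] varsigma_epsilon_seq[of k]
      varsigma_epsilon_seq[of "2 * k"] varsigma_epsilon_seq[of "2 * k - 1"]
    by (simp add: power_mult_distrib)
qed

end
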